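(* Let $G$ be a connected vertex-transitive graph (loops and multiple edges allowed) with finite degree $d\ge 1$ and spectral radius $\lambda$. Let $\delta_{\rm FMSF}(G)$ be the expected degree of the free minimal spanning forest of $G$. Then $$\frac{1}{4\lambda}-\frac14\;\le\;\delta_{\rm FMSF}(G)\;\le\; d .$$
   Context: Graphs. A graph $G=(V,E^\sharp)$ consists of a vertex set $V$ and a set $E^\sharp$ of oriented edges; each $e\in E^\sharp$ has a tail $\underline e\in V$, a head $\overline e\in V$, and an opposite oriented edge $\hat e\in E^\sharp$ (with tail $\overline e$, head $\underline e$, and $\hat{\hat e}=e$), and $e\ne\hat e$ for all $e\in E^\sharp$. Loops and multiple edges are allowed. An (unoriented) edge is an unordered pair $\{e,\hat e\}$; $E$ is the set of edges. $G$ is vertex-transitive if for all $x,y\in V$ there is an automorphism of $G$ mapping $x$ to $y$. The degree $d$ is the number of oriented edges with tail $x$ (independent of $x\in V$). Paths and cycles. A path of length $n$ from $x$ to $y$ is a sequence $(e_1,\dots,e_n)$ of oriented edges with $\overline{e_i}=\underline{e_{i+1}}$ for $1\le i<n$, $\underline{e_1}=x$, $\overline{e_n}=y$. It is a cycle rooted at $x$ if $x=y$. A cycle is simple if no vertex is visited twice (apart from the return to the root at the end) and it is not of the form $(e,\hat e)$; in particular a loop is a simple cycle of length $1$. Let $c(n)$ be the number of cycles of length $n$ rooted at $x$ (independent of $x$ by vertex-transitivity). Spectral radius. $\lambda:=\frac1d\limsup_{n\to\infty}c(n)^{1/n}$. Free minimal spanning forest. A spanning subgraph of $G$ (a subgraph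 with vertex set $V$) is identified with an element of $\{0,1\}^E$; a forest is a subgraph containing no simple cycles. Define $\Phi:[0,1]^E\to\{0,1\}^E$ as follows: given a labelling $x\in[0,1]^E$ of the edges, an edge is removed if and only if it belongs to some simple cycle of $G$ in which its label is maximal among the labels of the edges of that cycle; $\Phi(x)$ is the spanning subgraph formed by the remaining edges. The measure $\mathrm{FMSF}$ is the push-forward $\Phi_*(\mu^{\otimes E})$, where $\mu$ is Lebesgue measure on $[0,1]$. The number $\delta_{\rm FMSF}(G)$ is the expected degree, with respect to $\mathrm{FMSF}$, of a fixed vertex $x\in V$ in the random spanning subgraph (independent of the choice of $x$). *)

theory Defs
  imports
    "HOL-Probability.Probability"
    "Graph_Theory.Bidirected_Digraph"
    "Graph_Theory.Arc_Walk"
    "Graph_Theory.Digraph_Component"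
begin

text \<open>
  A graph is a \<^locale>\<open>bidirected_digraph\<close>: the arcs are the oriented edges and \<open>arev\<close> is the
  fixed-point-free involution sending an oriented edge to its opposite. Nothing is assumed
  finite, and loops and parallel edges are allowed; an unoriented loop consists of two arcs.
  (That \<open>arev\<close> is the identity off the arcs is only the locale's convention for total functions.)
\<close>

definition graph_automorphism ::
    "('a,'b) pre_digraph \<Rightarrow> ('b \<Rightarrow> 'b) \<Rightarrow> ('a \<Rightarrow> 'a) \<Rightarrow> ('b \<Rightarrow> 'b) \<Rightarrow> bool" where
  "graph_automorphism G arev f g \<longleftrightarrow>
     bij_betw f (verts G) (verts G) \<and> bij_betw g (arcs G) (arcs G) \<and>
     (\<forall>a\<in>arcs G. tail G (g a) = f (tail G a) \<and> head G (g a) = f (head G a) \<and>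
                 g (arev a) = arev (g a))"

definition vertex_transitive :: "('a,'b) pre_digraph \<Rightarrow> ('b \<Rightarrow> 'b) \<Rightarrow> bool" where
  "vertex_transitive G arev \<longleftrightarrow>
     (\<forall>x\<in>verts G. \<forall>y\<in>verts G. \<exists>f g. graph_automorphism G arev f g \<and> f x = y)"

definition num_rooted_cycles :: "('a,'b) pre_digraph \<Rightarrow> 'a \<Rightarrow> nat \<Rightarrow> nat" where
  "num_rooted_cycles G x n = card {p. pre_digraph.awalk G x p x \<and> length p = n}"

text \<open>
  The limit superior is taken in the extended reals. At a vertex of a regular graph of degree
  \<open>d\<close> the number of rooted cycles of length \<open>n\<close> is at most \<open>d ^ n\<close>, so that it is finite and the
  conversion to a real number loses nothing.
\<close>

definition spectral_radius :: "('a,'b) pre_digraph \<Rightarrow> 'a \<Rightarrow> real" where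
  "spectral_radius G x =
     1 / real (out_degree G x) *
       real_of_ereal (limsup (\<lambda>n. ereal (root n (real (num_rooted_cycles G x n)))))"

definition unoriented :: "('b \<Rightarrow> 'b) \<Rightarrow> 'b \<Rightarrow> 'b set" where
  "unoriented arev a = {a, arev a}"

definition edges :: "('a,'b) pre_digraph \<Rightarrow> ('b \<Rightarrow> 'b) \<Rightarrow> 'b set set" where
  "edges G arev = unoriented arev ` arcs G"

text \<open>
  The library's notion of a cycle (nonempty, closed, no vertex repeated except for the root)
  still admits going back and forth along a single edge.
\<close>

definition simple_cycle :: "('a,'b) pre_digraph \<Rightarrow> ('b \<Rightarrow> 'b) \<Rightarrow> 'b list \<Rightarrow> bool" where
  "simple_cycle G arev p \<longleftrightarrow> pre_digraph.cycle G p \<and> \<not> (\<exists>e. p = [e, arev e])"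

definition removed_edge ::
    "('a,'b) pre_digraph \<Rightarrow> ('b \<Rightarrow> 'b) \<Rightarrow> ('b set \<Rightarrow> real) \<Rightarrow> 'b set \<Rightarrow> bool" where
  "removed_edge G arev l e \<longleftrightarrow>
     (\<exists>p. simple_cycle G arev p \<and> e \<in> unoriented arev ` set p \<and>
          (\<forall>e'\<in>unoriented arev ` set p. l e' \<le> l e))"

text \<open>
  The space of spanning subgraphs is \<open>{False, True}\<close> to the power of the edge set, realised as
  the extensional functions that form the space of the product measure.
\<close>

definition fmsf_map ::
    "('a,'b) pre_digraph \<Rightarrow> ('b \<Rightarrow> 'b) \<Rightarrow> ('b set \<Rightarrow> real) \<Rightarrow> ('b set \<Rightarrow> bool)" where
  "fmsf_map G arev l = (\<lambda>e\<in>edges G arev. \<not> removed_edge G arev l e)"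

definition label_measure :: "('a,'b) pre_digraph \<Rightarrow> ('b \<Rightarrow> 'b) \<Rightarrow> ('b set \<Rightarrow> real) measure" where
  "label_measure G arev = (\<Pi>\<^sub>M e\<in>edges G arev. restrict_space lborel {0..1})"

definition subgraph_space :: "('a,'b) pre_digraph \<Rightarrow> ('b \<Rightarrow> 'b) \<Rightarrow> ('b set \<Rightarrow> bool) measure" where
  "subgraph_space G arev = (\<Pi>\<^sub>M e\<in>edges G arev. count_space (UNIV :: bool set))"

definition FMSF :: "('a,'b) pre_digraph \<Rightarrow> ('b \<Rightarrow> 'b) \<Rightarrow> ('b set \<Rightarrow> bool) measure" where
  "FMSF G arev = distr (label_measure G arev) (subgraph_space G arev) (fmsf_map G arev)"

definition subgraph_degree ::
    "('a,'b) pre_digraph \<Rightarrow> ('b \<Rightarrow> 'b) \<Rightarrow> ('b set \<Rightarrow> bool) \<Rightarrow> 'a \<Rightarrow> nat" where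
  "subgraph_degree G arev s x = card {a \<in> out_arcs G x. s (unoriented arev a)}"

definition delta_FMSF :: "('a,'b) pre_digraph \<Rightarrow> ('b \<Rightarrow> 'b) \<Rightarrow> 'a \<Rightarrow> real" where
  "delta_FMSF G arev x = (\<integral>s. real (subgraph_degree G arev s x) \<partial>FMSF G arev)"

text \<open>
  A connected graph of finite degree has countably many arcs. Then the map above is measurable,
  so that its push-forward is a genuine probability measure, and the degree is integrable.
\<close>

lemma fmsf_map_measurable:
  fixes G :: "('a,'b) pre_digraph"
  assumes "countable (arcs G)"
  shows "fmsf_map G arev \<in> label_measure G arev \<rightarrow>\<^sub>M subgraph_space G arev"
proof -
  define C where "C = {p. simple_cycle G arev p}"
  have CE: "unoriented arev ` set p \<subseteq> edges G arev" if "p \<in> C" for p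
    using that by (auto simp: C_def simple_cycle_def pre_digraph.cycle_def
        pre_digraph.awalk_def edges_def)
  have "C \<subseteq> lists (arcs G)"
    by (auto simp: C_def simple_cycle_def pre_digraph.cycle_def pre_digraph.awalk_def)
  then have C: "countable C"
    using assms countable_lists countable_subset by blast
  have comp: "(\<lambda>l. l e) \<in> borel_measurable (label_measure G arev)" if "e \<in> edges G arev" for e
  proof -
    have "(\<lambda>l. l e) \<in> label_measure G arev \<rightarrow>\<^sub>M restrict_space lborel {0..1::real}"
      unfolding label_measure_def using that by (rule measurable_component_singleton)
    then show ?thesis
      by (simp add: measurable_restrict_space2_iff)
  qed
  have pred: "Measurable.pred (label_measure G arev) (\<lambda>l. \<not> removed_edge G arev l e)"
    if e: "e \<in> edges G arev" for e
  proof -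
    have eq: "removed_edge G arev l e \<longleftrightarrow>
        (\<exists>p\<in>C. e \<in> unoriented arev ` set p \<and> (\<forall>e'\<in>unoriented arev ` set p. l e' \<le> l e))" for l
      by (auto simp: removed_edge_def C_def)
    have le: "Measurable.pred (label_measure G arev) (\<lambda>l. l e' \<le> l e)"
      if "p \<in> C" "e' \<in> unoriented arev ` set p" for p e'
      unfolding pred_def using CE[OF that(1)] that(2) by (intro borel_measurable_le comp e) auto
    have fin: "finite (unoriented arev ` set p)" for p :: "'b list"
      by simp
    have cyc: "Measurable.pred (label_measure G arev)
        (\<lambda>l. e \<in> unoriented arev ` set p \<and> (\<forall>e'\<in>unoriented arev ` set p. l e' \<le> l e))"
      if "p \<in> C" for p
      using le[OF that] by (intro pred_intros_logic pred_intros_finite fin) auto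
    have "Measurable.pred (label_measure G arev) (\<lambda>l. removed_edge G arev l e)"
      unfolding eq pred_def
      by (intro sets.sets_Collect_countable_Ex' C) (use cyc in \<open>simp add: pred_def\<close>)
    then show ?thesis
      by simp
  qed
  show ?thesis
    unfolding fmsf_map_def[abs_def] subgraph_space_def
    by (rule measurable_restrict) (use pred in simp)
qed

lemma prob_space_FMSF:
  assumes "countable (arcs G)"
  shows "prob_space (FMSF G arev)"
proof -
  have "prob_space (restrict_space lborel {0..1::real})"
    by (rule prob_spaceI) (simp add: emeasure_restrict_space space_restrict_space)
  then have "prob_space (label_measure G arev)"
    unfolding label_measure_def by (intro prob_space_PiM)
  then show ?thesis
    unfolding FMSF_def by (rule prob_space.prob_space_distr) (rule fmsf_map_measurable[OF assms])
qed

lemma integrable_subgraph_degree: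
  assumes "countable (arcs G)" "finite (out_arcs G x)"
  shows "integrable (FMSF G arev) (\<lambda>s. real (subgraph_degree G arev s x))"
proof -
  interpret prob_space "FMSF G arev"
    by (rule prob_space_FMSF[OF assms(1)])
  have eq: "real (subgraph_degree G arev s x) =
      (\<Sum>a\<in>out_arcs G x. if s (unoriented arev a) then 1 else 0)" for s
    using assms(2) by (simp add: subgraph_degree_def sum.If_cases Int_def)
  have "(\<lambda>s. real (subgraph_degree G arev s x)) \<in> borel_measurable (subgraph_space G arev)"
    unfolding eq
  proof (rule borel_measurable_sum)
    fix a assume "a \<in> out_arcs G x"
    then have "unoriented arev a \<in> edges G arev"
      by (auto simp: edges_def out_arcs_def)
    then have "(\<lambda>s. s (unoriented arev a)) \<in> subgraph_space G arev \<rightarrow>\<^sub>M count_space UNIV"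
      unfolding subgraph_space_def by (rule measurable_component_singleton)
    then show "(\<lambda>s. if s (unoriented arev a) then 1 else 0 :: real)
        \<in> borel_measurable (subgraph_space G arev)"
      by measurable
  qed
  then have "(\<lambda>s. real (subgraph_degree G arev s x)) \<in> borel_measurable (FMSF G arev)"
    by (simp add: FMSF_def)
  moreover have "real (subgraph_degree G arev s x) \<le> real (card (out_arcs G x))" for s
    unfolding subgraph_degree_def by (auto intro: card_mono assms(2))
  ultimately show ?thesis
    by (intro integrable_const_bound[where B = "real (card (out_arcs G x))"]) auto
qed

end

theory Submission
  imports Defs
begin

text \<open>
  Let \<open>c n\<close> be the number of rooted cycles of length \<open>n\<close>. It is supermultiplicative, so that
  \<open>c n \<le> L ^ n\<close> for \<open>L = d \<lambda>\<close>, and \<open>c 2 \<ge> d\<close> gives \<open>L \<ge> 1\<close>. Put \<open>p = 1 / (2 L)\<close>. The expected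
  number of arcs at \<open>x\<close> with label at most \<open>p\<close> is \<open>d p\<close>. Such an arc can only be removed if it
  starts a closed walk at \<open>x\<close> through distinct edges all of whose labels are at most \<open>p\<close>; the
  expected number of these walks is at most \<open>\<Sum>n\<ge>1. c n p ^ n \<le> \<Sum>n\<ge>1. 2 ^ -n = 1\<close>. Hence the
  expected degree is at least \<open>d p - 1 = u / 2 - 1\<close>, where \<open>u = 1 / \<lambda>\<close>.

  For \<open>u \<ge> 3\<close> this is at least \<open>(u - 1) / 4\<close>. For \<open>u \<le> 5\<close> it suffices that the expected degree is
  at least 1, which holds because almost surely the non-loop at \<open>x\<close> with the smallest label is kept.
  If there are only loops at \<open>x\<close>, then \<open>c n = d ^ n\<close>, and \<open>u = 1\<close>.
\<close>

subsection \<open>Walks and simple cycles\<close>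

lemma bij_betw_out_arcs_automorphism:
  assumes "graph_automorphism G arev f g" "wf_digraph G" "v \<in> verts G"
  shows "bij_betw g (out_arcs G v) (out_arcs G (f v))"
proof -
  interpret wf_digraph G by fact
  have f: "bij_betw f (verts G) (verts G)" and g: "bij_betw g (arcs G) (arcs G)"
    and t: "\<And>a. a \<in> arcs G \<Longrightarrow> tail G (g a) = f (tail G a)"
    using assms(1) by (auto simp: graph_automorphism_def)
  have "inj_on g (out_arcs G v)"
    using g by (auto simp: bij_betw_def intro: inj_on_subset)
  moreover have "g ` out_arcs G v = out_arcs G (f v)"
  proof
    show "g ` out_arcs G v \<subseteq> out_arcs G (f v)"
      using g t by (auto simp: bij_betw_def)
    show "out_arcs G (f v) \<subseteq> g ` out_arcs G v"
    proof
      fix b assume b: "b \<in> out_arcs G (f v)"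
      then obtain a where a: "a \<in> arcs G" "b = g a"
        using g by (auto simp: bij_betw_def)
      then have "f (tail G a) = f v"
        using b t by simp
      then have "tail G a = v"
        using f assms(3) a by (auto simp: bij_betw_def inj_on_def)
      then show "b \<in> g ` out_arcs G v"
        using a by auto
    qed
  qed
  ultimately show ?thesis
    by (simp add: bij_betw_def)
qed

text \<open>Finiteness and degree are known at \<open>x\<close> only; an automorphism taking
  \<open>x\<close> to \<open>v\<close> carries both over to \<open>v\<close>.\<close>

lemma vertex_transitive_out_arcs:
  assumes "vertex_transitive G arev" "wf_digraph G" "x \<in> verts G" "v \<in> verts G"
    and "finite (out_arcs G x)"
  shows "finite (out_arcs G v)" "out_degree G v = out_degree G x"
proof -
  obtain f g where "graph_automorphism G arev f g" "f x = v"
    using assms(1,3,4) unfolding vertex_transitive_def by blast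
  then have "bij_betw g (out_arcs G x) (out_arcs G v)"
    using bij_betw_out_arcs_automorphism assms by metis
  then show "finite (out_arcs G v)" "out_degree G v = out_degree G x"
    using assms(5) by (auto simp: out_degree_def bij_betw_finite bij_betw_same_card)
qed

section \<open>Counting walks in locally finite digraphs\<close>

context wf_digraph
begin

text \<open>The end vertex is left free because removing the first arc of a closed walk need not
  leave a closed one. This is the recursion behind the next two inductions.\<close>

lemma walks_Suc:
  "{p. (\<exists>v. awalk u p v) \<and> length p = Suc n} =
    (\<Union>a\<in>out_arcs G u. Cons a ` {p. (\<exists>v. awalk (head G a) p v) \<and> length p = n})"
  by (fastforce simp: length_Suc_conv awalk_Cons_iff image_iff)

lemma finite_walks:
  assumes fin: "\<And>v. v \<in> verts G \<Longrightarrow> finite (out_arcs G v)" and "u \<in> verts G"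
  shows "finite {p. (\<exists>v. awalk u p v) \<and> length p = n}"
  using \<open>u \<in> verts G\<close>
proof (induction n arbitrary: u)
  case (Suc n)
  then show ?case
    unfolding walks_Suc by (auto intro!: fin)
qed simp

lemma card_walks_le:
  assumes fin: "\<And>v. v \<in> verts G \<Longrightarrow> finite (out_arcs G v)"
    and deg: "\<And>v. v \<in> verts G \<Longrightarrow> out_degree G v \<le> d"
    and "u \<in> verts G"
  shows "card {p. (\<exists>v. awalk u p v) \<and> length p = n} \<le> d ^ n"
  using \<open>u \<in> verts G\<close>
proof (induction n arbitrary: u)
  case 0
  then have "{p. (\<exists>v. awalk u p v) \<and> length p = 0} = {[]}"
    by (auto simp: awalk_Nil_iff)
  then show ?case by simp
next
  case (Suc n)
  let ?W = "\<lambda>u. {p. (\<exists>v. awalk u p v) \<and> length p = n}"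
  have "card (\<Union>a\<in>out_arcs G u. Cons a ` ?W (head G a)) \<le> (\<Sum>a\<in>out_arcs G u. d ^ n)"
    using Suc.IH
    by (intro order_trans[OF card_UN_le[OF fin[OF Suc.prems]]] sum_mono) (simp add: card_image)
  also have "\<dots> \<le> d ^ Suc n"
    using deg[OF Suc.prems] by (simp add: out_degree_def)
  finally show ?case
    unfolding walks_Suc .
qed

text \<open>Each arc is the last arc of some walk from a fixed vertex, and only finitely many such
  walks have a given length. Measurability of \<open>fmsf_map\<close> rests on this.\<close>

lemma countable_arcs_if_locally_finite:
  assumes "strongly_connected G" and fin: "\<And>v. v \<in> verts G \<Longrightarrow> finite (out_arcs G v)"
  shows "countable (arcs G)"
proof -
  obtain x where x: "x \<in> verts G"
    using assms(1) by (auto simp: strongly_connected_def)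
  define W where "W = (\<lambda>n. {p. (\<exists>v. awalk x p v) \<and> length p = n})"
  have finW: "finite (W n)" for n
    unfolding W_def using fin x by (rule finite_walks)
  have "arcs G \<subseteq> (\<Union>n. \<Union>p\<in>W n. set p)"
  proof
    fix a assume a: "a \<in> arcs G"
    then obtain p where "awalk x p (tail G a)"
      using assms(1) x unfolding strongly_connected_def reachable_awalk
      by (meson tail_in_verts)
    then have "awalk x (p @ [a]) (head G a)"
      using a arc_implies_awalk awalk_appendI by blast
    then have "p @ [a] \<in> W (length (p @ [a]))"
      by (auto simp: W_def simp del: awalk_append_iff)
    moreover have "a \<in> set (p @ [a])" by simp
    ultimately show "a \<in> (\<Union>n. \<Union>p\<in>W n. set p)" by blast
  qed
  moreover have "countable (\<Union>n. \<Union>p\<in>W n. set p)"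
    using finW by (auto intro: countable_finite)
  ultimately show ?thesis
    by (rule countable_subset)
qed

end

section \<open>Simple cycles: distinct edges, reversal and rotation\<close>

context bidirected_digraph
begin

lemma unoriented_arev [simp]: "unoriented arev (arev a) = unoriented arev a"
  by (auto simp: unoriented_def)

lemma unoriented_eq_iff: "unoriented arev a = unoriented arev b \<longleftrightarrow> a = b \<or> a = arev b"
  by (auto simp: unoriented_def doubleton_eq_iff)

lemma awalk_reverse:
  assumes "awalk u p v"
  shows "awalk v (rev (map arev p)) u"
  using assms
proof (induction p arbitrary: u)
  case (Cons a p)
  then have a: "a \<in> arcs G" "u = tail G a" and p: "awalk (head G a) p v"
    by (auto simp: awalk_Cons_iff)
  have "awalk (head G a) [arev a] u"
    using a arc_implies_awalk[of "arev a"] by simp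
  then show ?case
    using awalk_appendI[OF Cons.IH[OF p]] by simp
qed (auto simp: awalk_Nil_iff)

text \<open>The library lists the root of a cycle at both ends and drops the first occurrence.
  Dropping the last one instead leaves the tails of the arcs.\<close>

lemma simple_cycle_vertices_distinct:
  assumes "simple_cycle G arev p"
  obtains u where "awalk u p u" "p \<noteq> []" "distinct (map (tail G) p)"
proof -
  obtain u where u: "awalk u p u" "distinct (tl (awalk_verts u p))" "p \<noteq> []"
    using assms by (auto simp: simple_cycle_def cycle_def)
  have 1: "awalk_verts u p = map (tail G) p @ [u]"
    using u(1,3) awlast_of_awalk[OF u(1)] by (simp add: awalk_verts_conv)
  have 2: "tail G (hd p) = u"
    using u(1,3) by (cases p) (auto simp: awalk_Cons_iff)
  have "distinct (map (tail G) p)"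
    using u(2,3) 2 unfolding 1 by (cases p) auto
  then show thesis
    using u that by blast
qed

text \<open>Two arcs over one edge with distinct tails are opposite. Any further arc between, after
  or before them would have the same tail as one of them, so the cycle is
  \<open>[a, arev a]\<close>, which is excluded.\<close>

lemma simple_cycle_edges_distinct:
  assumes "simple_cycle G arev p"
  shows "distinct (map (unoriented arev) p)"
proof (rule ccontr)
  obtain u where u: "awalk u p u" "p \<noteq> []" "distinct (map (tail G) p)"
    using simple_cycle_vertices_distinct[OF assms] .
  assume "\<not> distinct (map (unoriented arev) p)"
  then obtain as a bs b cs where p: "p = as @ a # bs @ b # cs"
    and ab: "unoriented arev a = unoriented arev b"
    by (auto dest!: not_distinct_decomp simp: map_eq_append_conv map_eq_Cons_conv
        append_eq_map_conv Cons_eq_map_conv)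
  have "a \<noteq> b"
    using u(3) p by auto
  then have a: "a = arev b"
    using ab by (simp add: unoriented_eq_iff)
  have arcs: "b \<in> arcs G"
    using u(1) p by (auto simp: awalk_Cons_iff)
  have "bs = []"
  proof (cases bs)
    case (Cons c bs')
    then have "tail G c = head G a"
      using u(1) p by (simp add: awalk_Cons_iff)
    then show ?thesis
      using u(3) p Cons a arcs by simp
  qed
  have "cs = []"
  proof (cases cs)
    case (Cons c cs')
    then have "tail G c = head G b"
      using u(1) p \<open>bs = []\<close> by (simp add: awalk_Cons_iff)
    then show ?thesis
      using u(3) p Cons a arcs by simp
  qed
  have "head G b = u"
    using u(1) p \<open>bs = []\<close> \<open>cs = []\<close> by (auto simp: awalk_simps)
  have "as = []"
  proof (cases as)
    case (Cons c as')
    then have "tail G c = u"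
      using u(1) p by (simp add: awalk_Cons_iff)
    then show ?thesis
      using u(3) p Cons a arcs \<open>head G b = u\<close> by simp
  qed
  have "p = [a, arev a]"
    using p a \<open>as = []\<close> \<open>bs = []\<close> \<open>cs = []\<close> by simp
  then show False
    using assms by (auto simp: simple_cycle_def)
qed

text \<open>A loop returns to its vertex at once, so no arc can precede or follow it without
  repeating a vertex.\<close>

lemma simple_cycle_no_loops:
  assumes "simple_cycle G arev p" "length p \<noteq> 1" "b \<in> set p"
  shows "tail G b \<noteq> head G b"
proof
  assume loop: "tail G b = head G b"
  obtain u where u: "awalk u p u" "distinct (map (tail G) p)"
    using simple_cycle_vertices_distinct[OF assms(1)] .
  obtain as bs where p: "p = as @ b # bs"
    using assms(3) by (auto simp: in_set_conv_decomp)
  have "bs = []"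
  proof (cases bs)
    case (Cons c bs')
    then have "tail G c = head G b"
      using u(1) p by (simp add: awalk_Cons_iff)
    then show ?thesis
      using u(2) p Cons loop by simp
  qed
  moreover have "as = []"
  proof (cases as)
    case (Cons c as')
    then have "tail G c = u" "head G b = u"
      using u(1) p \<open>bs = []\<close> by (auto simp: awalk_simps)
    then show ?thesis
      using u(2) p Cons loop by simp
  qed
  ultimately show False
    using assms(2) p by simp
qed

text \<open>Rotate the cycle, after reversing it if it contains \<open>arev a\<close> instead of \<open>a\<close>.\<close>

lemma simple_cycle_reroot:
  assumes p: "simple_cycle G arev p" and a: "a \<in> out_arcs G x"
    and ap: "unoriented arev a \<in> unoriented arev ` set p"
  obtains q where "awalk x (a # q) x" "distinct (map (unoriented arev) (a # q))"
    "unoriented arev ` set (a # q) = unoriented arev ` set p"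
    "\<And>b. q \<noteq> [] \<Longrightarrow> b \<in> set (a # q) \<Longrightarrow> tail G b \<noteq> head G b"
proof -
  obtain u where u: "awalk u p u"
    using simple_cycle_vertices_distinct[OF p] .
  define r where "r = (if a \<in> set p then p else rev (map arev p))"
  have r_walk: "awalk u r u"
    using u awalk_reverse[OF u] by (simp add: r_def)
  have "a \<in> set r"
    using ap by (auto simp: r_def unoriented_eq_iff)
  have unor: "map (unoriented arev) (rev (map arev p)) = rev (map (unoriented arev) p)"
    by (simp add: rev_map comp_def)
  have r_dist: "distinct (map (unoriented arev) r)"
    using simple_cycle_edges_distinct[OF p] unfolding r_def
    by (simp only: unor distinct_rev if_split_mem2 split: if_split) simp
  have r_set: "unoriented arev ` set r = unoriented arev ` set p"
    by (auto simp: r_def image_image)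
  have "set p \<subseteq> arcs G"
    using u by blast
  then have r_loop: "tail G b \<noteq> head G b" if "length r \<noteq> 1" "b \<in> set r" for b
    using simple_cycle_no_loops[OF p] that by (auto simp: r_def split: if_splits) fastforce+
  obtain as bs where r: "r = as @ a # bs"
    using \<open>a \<in> set r\<close> by (auto simp: in_set_conv_decomp)
  have "tail G a = x"
    using a by simp
  then have "awalk u as x" "awalk x (a # bs) u"
    using r_walk unfolding r by (auto simp: awalk_Cons_iff)
  then have "awalk x (a # bs @ as) x"
    using awalk_appendI[of x "a # bs" u as x] by simp
  moreover have "distinct (map (unoriented arev) (a # bs @ as))"
    using r_dist unfolding r by auto
  moreover have "unoriented arev ` set (a # bs @ as) = unoriented arev ` set p"
    unfolding r_set[symmetric] r by auto
  moreover have "tail G b \<noteq> head G b" if "bs @ as \<noteq> []" "b \<in> set (a # bs @ as)" for b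
    using r_loop[of b] that unfolding r by auto
  ultimately show thesis
    by (rule that)
qed

text \<open>The form in which removal is used: distinct edges have independent labels, and the
  absence of loops serves \<open>exists_kept_arc\<close>.\<close>

lemma removed_edgeE:
  assumes "removed_edge G arev l (unoriented arev a)" "a \<in> out_arcs G x"
  obtains q where "awalk x (a # q) x" "distinct (map (unoriented arev) (a # q))"
    "\<And>e. e \<in> unoriented arev ` set (a # q) \<Longrightarrow> l e \<le> l (unoriented arev a)"
    "\<And>b. q \<noteq> [] \<Longrightarrow> b \<in> set (a # q) \<Longrightarrow> tail G b \<noteq> head G b"
proof -
  obtain p where p: "simple_cycle G arev p" "unoriented arev a \<in> unoriented arev ` set p"
    "\<And>e. e \<in> unoriented arev ` set p \<Longrightarrow> l e \<le> l (unoriented arev a)"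
    using assms(1) by (auto simp: removed_edge_def)
  show thesis
    by (rule simple_cycle_reroot[OF p(1) assms(2) p(2)]) (use that p(3) in metis)
qed

text \<open>If the labels at \<open>x\<close> are distinct, then the non-loop at \<open>x\<close> with the smallest label survives:
  a longer cycle through it returns to \<open>x\<close> along another non-loop.\<close>

lemma exists_kept_arc:
  assumes inj: "inj_on l (unoriented arev ` out_arcs G x)"
    and fin: "finite (out_arcs G x)"
    and ex: "\<exists>a\<in>out_arcs G x. head G a \<noteq> x"
  shows "\<exists>a\<in>out_arcs G x. \<not> removed_edge G arev l (unoriented arev a)"
proof -
  define S where "S = {a \<in> out_arcs G x. head G a \<noteq> x}"
  have S: "finite S"
    unfolding S_def by (rule rev_finite_subset[OF fin]) blast
  moreover have "S \<noteq> {}"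
    using ex by (auto simp: S_def)
  ultimately obtain a where a: "a \<in> S" and
    min: "\<And>b. b \<in> S \<Longrightarrow> l (unoriented arev a) \<le> l (unoriented arev b)"
    using ex_is_arg_min_if_finite[of S "\<lambda>a. l (unoriented arev a)"]
    by (auto simp: is_arg_min_linorder)
  have ax: "a \<in> out_arcs G x" "head G a \<noteq> x"
    using a by (auto simp: S_def)
  have "\<not> removed_edge G arev l (unoriented arev a)"
  proof
    assume "removed_edge G arev l (unoriented arev a)"
    then obtain q where q: "awalk x (a # q) x" "distinct (map (unoriented arev) (a # q))"
      "\<And>e. e \<in> unoriented arev ` set (a # q) \<Longrightarrow> l e \<le> l (unoriented arev a)"
      "\<And>b. q \<noteq> [] \<Longrightarrow> b \<in> set (a # q) \<Longrightarrow> tail G b \<noteq> head G b"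
      using ax(1) by (rule removed_edgeE) blast
    have "q \<noteq> []"
      using q(1) ax by (auto simp: awalk_simps)
    then obtain q' b where b: "q = q' @ [b]"
      by (metis rev_exhaust)
    have b': "b \<in> arcs G" "head G b = x"
      using q(1) b by (auto simp: awalk_simps)
    have "tail G b \<noteq> head G b"
      using q(4)[OF \<open>q \<noteq> []\<close>, of b] b by simp
    then have bS: "arev b \<in> S"
      using b' by (auto simp: S_def)
    \<comment> \<open>Maximality on the cycle and minimality in \<open>S\<close> squeeze the two
      labels together. As labels are distinct, \<open>b\<close> then lies over the edge of
      \<open>a\<close>, which the walk uses only once.\<close>
    have "l (unoriented arev b) \<le> l (unoriented arev a)"
      using q(3)[of "unoriented arev b"] b by simp
    then have "l (unoriented arev b) = l (unoriented arev a)"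
      using min[OF bS] by simp
    moreover have "unoriented arev b \<in> unoriented arev ` out_arcs G x"
      using bS by (metis (no_types, lifting) S_def image_eqI mem_Collect_eq unoriented_arev)
    ultimately have "unoriented arev b = unoriented arev a"
      using inj ax(1) by (auto dest: inj_onD)
    then show False
      using q(2) b by simp
  qed
  then show ?thesis
    using ax by blast
qed

end

subsection \<open>Growth of the number of rooted cycles\<close>

text \<open>Along the multiples of \<open>n\<close> the roots never fall below the root at
  \<open>n\<close>, and a subsequence cannot have a larger limsup.\<close>

lemma root_le_limsup_if_power_le:
  fixes c :: "nat \<Rightarrow> nat"
  assumes "\<And>k. c n ^ k \<le> c (n * k)" "n \<ge> 1"
  shows "ereal (root n (real (c n))) \<le> limsup (\<lambda>m. ereal (root m (real (c m))))"
proof -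
  \<comment> \<open>\<open>Suc k\<close> skips the index 0, where \<open>root\<close> is 0 by
    convention.\<close>
  define r where "r = (\<lambda>k. n * Suc k)"
  have r: "strict_mono r"
    using assms(2) by (auto simp: r_def intro!: strict_monoI)
  have "root n (real (c n)) \<le> root (r k) (real (c (r k)))" for k
  proof -
    have "root n (real (c n)) = root (n * Suc k) (real (c n) ^ Suc k)"
      unfolding real_root_mult_exp by (simp only: real_root_power_cancel zero_less_Suc of_nat_0_le_iff)
    also have "\<dots> \<le> root (r k) (real (c (r k)))"
      unfolding r_def using assms
      by (intro real_root_le_mono) (simp, metis of_nat_le_iff of_nat_power)
    finally show ?thesis .
  qed
  then have "ereal (root n (real (c n))) \<le> limsup ((\<lambda>m. ereal (root m (real (c m)))) \<circ> r)"
    by (intro le_Limsup) auto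
  also have "\<dots> \<le> limsup (\<lambda>m. ereal (root m (real (c m))))"
    by (rule limsup_subseq_mono[OF r])
  finally show ?thesis .
qed

text \<open>What vertex-transitivity contributes to the counting: a finite out-degree that is the
  same everywhere.\<close>

locale locally_finite_regular = bidirected_digraph +
  fixes d :: nat
  assumes finite_out_arcs: "v \<in> verts G \<Longrightarrow> finite (out_arcs G v)"
    and out_degree_eq: "v \<in> verts G \<Longrightarrow> out_degree G v = d"
begin

lemma finite_closed_walks: "finite {p. awalk x p x \<and> length p = n}"
proof (cases "x \<in> verts G")
  case True
  then show ?thesis
    using finite_walks[OF finite_out_arcs True, of n] by (auto elim!: rev_finite_subset)
qed (auto simp: awalk_def)

lemma num_rooted_cycles_le:
  assumes "x \<in> verts G"
  shows "num_rooted_cycles G x n \<le> d ^ n"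
proof -
  have "num_rooted_cycles G x n \<le> card {p. (\<exists>v. awalk x p v) \<and> length p = n}"
    unfolding num_rooted_cycles_def using finite_walks[OF finite_out_arcs assms]
    by (intro card_mono) auto
  also have "\<dots> \<le> d ^ n"
    using finite_out_arcs out_degree_eq assms by (intro card_walks_le) auto
  finally show ?thesis .
qed

text \<open>Concatenation of closed walks at \<open>x\<close> is injective once the length of the
  first factor is fixed.\<close>

lemma num_rooted_cycles_mult:
  "num_rooted_cycles G x m * num_rooted_cycles G x n \<le> num_rooted_cycles G x (m + n)"
proof -
  let ?C = "\<lambda>n. {p. awalk x p x \<and> length p = n}"
  have "card (?C m \<times> ?C n) = card ((\<lambda>(p, q). p @ q) ` (?C m \<times> ?C n))"
    by (intro card_image[symmetric]) (auto simp: inj_on_def)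
  also have "\<dots> \<le> card (?C (m + n))"
    using awalk_appendI by (intro card_mono finite_closed_walks) (auto simp del: awalk_append_iff)
  finally show ?thesis
    by (simp add: num_rooted_cycles_def card_cartesian_product)
qed

lemma num_rooted_cycles_power:
  assumes "x \<in> verts G"
  shows "num_rooted_cycles G x n ^ k \<le> num_rooted_cycles G x (n * k)"
proof (induction k)
  case 0
  have "{p. awalk x p x \<and> length p = 0} = {[]}"
    using assms by (auto simp: awalk_Nil_iff)
  then show ?case by (simp add: num_rooted_cycles_def)
next
  case (Suc k)
  then have "num_rooted_cycles G x n ^ Suc k
      \<le> num_rooted_cycles G x n * num_rooted_cycles G x (n * k)"
    by simp
  also have "\<dots> \<le> num_rooted_cycles G x (n * Suc k)"
    using num_rooted_cycles_mult[of x n "n * k"] by simp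
  finally show ?case .
qed

text \<open>Traverse each arc at \<open>x\<close> and go straight back.\<close>

lemma degree_le_num_rooted_cycles_2:
  assumes "x \<in> verts G"
  shows "d \<le> num_rooted_cycles G x 2"
proof -
  have "card ((\<lambda>a. [a, arev a]) ` out_arcs G x) \<le> card {p. awalk x p x \<and> length p = 2}"
    by (intro card_mono finite_closed_walks) (auto simp: awalk_simps)
  moreover have "card ((\<lambda>a. [a, arev a]) ` out_arcs G x) = d"
    using out_degree_eq[OF assms] by (simp add: card_image inj_on_def out_degree_def)
  ultimately show ?thesis
    by (simp add: num_rooted_cycles_def)
qed

text \<open>Every list of loops at \<open>x\<close> is a closed walk.\<close>

lemma num_rooted_cycles_only_loops:
  assumes x: "x \<in> verts G" and loops: "\<forall>a\<in>out_arcs G x. head G a = x"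
  shows "d ^ n \<le> num_rooted_cycles G x n"
proof -
  have walk: "awalk x p x" if "p \<in> lists (out_arcs G x)" for p
    using that by (induction p) (use x loops in \<open>auto simp: awalk_simps\<close>)
  have "card {p. set p \<subseteq> out_arcs G x \<and> length p = n} = d ^ n"
    using finite_out_arcs[OF x] out_degree_eq[OF x]
    by (simp add: card_lists_length_eq out_degree_def)
  moreover have "card {p. set p \<subseteq> out_arcs G x \<and> length p = n}
      \<le> card {p. awalk x p x \<and> length p = n}"
    using walk by (intro card_mono finite_closed_walks) (auto simp: subset_iff in_lists_conv_set)
  ultimately show ?thesis
    by (simp add: num_rooted_cycles_def)
qed

text \<open>The factor \<open>d\<close> cancels the normalisation of the spectral radius, so
  \<open>L\<close> is the limsup itself. By supermultiplicativity it bounds the root for every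
  single \<open>n \<ge> 1\<close>; \<open>n = 2\<close> and \<open>n = 1\<close> give the two lower
  bounds on \<open>L\<close>.\<close>

lemma growth_rate:
  fixes L :: real
  assumes x: "x \<in> verts G" and "d \<ge> 1"
    and L: "L = real d * spectral_radius G x"
  shows "real (num_rooted_cycles G x n) \<le> L ^ n" "L \<ge> 1"
    and "\<forall>a\<in>out_arcs G x. head G a = x \<Longrightarrow> L \<ge> real d"
proof -
  let ?c = "num_rooted_cycles G x"
  let ?s = "limsup (\<lambda>n. ereal (root n (real (?c n))))"
  have le: "ereal (root n (real (?c n))) \<le> ?s" if "n \<ge> 1" for n
    using num_rooted_cycles_power[OF x] that by (rule root_le_limsup_if_power_le)
  have "root n (real (?c n)) \<le> real d" for n
  proof (cases "n = 0")
    case False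
    have "root n (real (?c n)) \<le> root n (real d ^ n)"
      using False num_rooted_cycles_le[OF x, of n]
      by (intro real_root_le_mono) (simp, metis of_nat_le_iff of_nat_power)
    with False show ?thesis
      by (simp add: real_root_power_cancel)
  qed simp
  then have "?s \<le> ereal (real d)"
    by (intro Limsup_bounded) auto
  moreover have "0 \<le> ?s"
    using le[of 1] by (auto intro: order_trans[rotated])
  moreover have "L = real_of_ereal ?s"
    using \<open>d \<ge> 1\<close> out_degree_eq[OF x] by (simp add: L spectral_radius_def)
  \<comment> \<open>The bounds 0 and \<open>d\<close> rule out infinite values of the
    limsup.\<close>
  ultimately have "?s = ereal L"
    by (cases ?s) auto
  with le have root: "root n (real (?c n)) \<le> L" if "n \<ge> 1" for n
    using that by simp
  have pow: "real (?c n) \<le> L ^ n" if "n \<ge> 1" for n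
  proof -
    have "real (?c n) = root n (real (?c n)) ^ n"
      using that by simp
    also have "\<dots> \<le> L ^ n"
      using root[OF that] by (intro power_mono real_root_ge_zero) auto
    finally show ?thesis .
  qed
  \<comment> \<open>The case \<open>n = 0\<close> needs its own argument: only the empty walk is
    counted.\<close>
  show "real (?c n) \<le> L ^ n"
    using pow[of n] num_rooted_cycles_le[OF x, of 0] by (cases "n = 0") auto
  have "1 \<le> real (?c 2)"
    using degree_le_num_rooted_cycles_2[OF x] \<open>d \<ge> 1\<close> by simp
  then have "root 2 1 \<le> root 2 (real (?c 2))"
    by (intro real_root_le_mono) auto
  then have "1 \<le> root 2 (real (?c 2))"
    by simp
  also have "\<dots> \<le> L"
    by (rule root) simp
  finally show "L \<ge> 1" .
  show "L \<ge> real d" if "\<forall>a\<in>out_arcs G x. head G a = x"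
    using num_rooted_cycles_only_loops[OF x that, of 1] root[of 1] by simp
qed

end

subsection \<open>Independent uniform labels\<close>

lemma prob_space_unit_interval: "prob_space (restrict_space lborel {0..1::real})"
  by (rule prob_spaceI) (simp add: emeasure_restrict_space space_restrict_space)

lemma prob_space_label_measure: "prob_space (label_measure G arev)"
  unfolding label_measure_def by (intro prob_space_PiM prob_space_unit_interval)

lemma measurable_label [measurable (raw)]:
  assumes "e \<in> edges G arev"
  shows "(\<lambda>l. l e) \<in> borel_measurable (label_measure G arev)"
proof -
  have "(\<lambda>l. l e) \<in> label_measure G arev \<rightarrow>\<^sub>M restrict_space lborel {0..1::real}"
    unfolding label_measure_def using assms by (rule measurable_component_singleton)
  then show ?thesis
    by (simp add: measurable_restrict_space2_iff)
qed

lemma label_in_unit_interval: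
  assumes "l \<in> space (label_measure G arev)" "e \<in> edges G arev"
  shows "l e \<in> {0..1}"
  using assms by (auto simp: label_measure_def space_PiM space_restrict_space)

text \<open>Independence: each edge in \<open>J\<close> contributes one factor, the length of the
  interval. A walk of length \<open>n\<close> thus yields an \<open>n\<close>-th power only if its
  edges are distinct.\<close>

lemma measure_label_box:
  assumes "finite J" "J \<subseteq> edges G arev" "0 \<le> \<alpha>" "\<alpha> \<le> \<beta>" "\<beta> \<le> 1"
  shows "measure (label_measure G arev) {l \<in> space (label_measure G arev). \<forall>e\<in>J. l e \<in> {\<alpha>..\<beta>}}
    = (\<beta> - \<alpha>) ^ card J"
proof -
  interpret product_prob_space "\<lambda>_. restrict_space lborel {0..1::real}" "edges G arev"
    by (intro product_prob_spaceI prob_space_unit_interval)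
  have sub: "{\<alpha>..\<beta>} \<subseteq> {0..1}"
    using assms by auto
  have "{\<alpha>..\<beta>} \<in> sets (restrict_space lborel {0..1})"
    using sub by (auto simp: sets_restrict_space_iff)
  then have "emeasure (label_measure G arev)
      {l \<in> space (label_measure G arev). \<forall>e\<in>J. l e \<in> {\<alpha>..\<beta>}}
      = (\<Prod>e\<in>J. emeasure (restrict_space lborel {0..1}) {\<alpha>..\<beta>})"
    unfolding label_measure_def using assms by (intro emeasure_PiM_Collect) auto
  also have "\<dots> = ennreal ((\<beta> - \<alpha>) ^ card J)"
    using assms sub by (simp add: emeasure_restrict_space ennreal_power)
  finally show ?thesis
    using assms by (simp add: measure_def)
qed

lemma AE_labels_distinct:
  assumes e: "e \<in> edges G arev" "f \<in> edges G arev" "e \<noteq> f"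
  shows "AE l in label_measure G arev. l e \<noteq> l f"
proof -
  let ?M = "label_measure G arev"
  interpret prob_space ?M
    by (rule prob_space_label_measure)
  let ?D = "{l \<in> space ?M. l e = l f}"
  have D: "?D \<in> events"
    using e by measurable
  \<comment> \<open>Cut the unit interval into \<open>N + 1\<close> pieces; equal labels lie in a common piece.\<close>
  have "prob ?D \<le> 1 / Suc N" for N
  proof -
    define I where "I k = {real k / Suc N..real (Suc k) / Suc N}" for k
    define B where "B k = {l \<in> space ?M. \<forall>g\<in>{e, f}. l g \<in> I k}" for k
    have B: "B k \<in> events" for k
    proof -
      have "Measurable.pred ?M (\<lambda>l. l e \<in> I k)" "Measurable.pred ?M (\<lambda>l. l f \<in> I k)"
        unfolding I_def using e by measurable
      then show ?thesis
        unfolding B_def by simp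
    qed
    have "?D \<subseteq> (\<Union>k<Suc N. B k)"
    proof
      fix l assume l: "l \<in> ?D"
      then have le: "0 \<le> l e" "l e \<le> 1"
        using label_in_unit_interval[of l G arev e] e by auto
      \<comment> \<open>The minimum with \<open>N\<close> puts the label 1 into the last piece,
        since its floor would be \<open>N + 1\<close>.\<close>
      define k where "k = min N (nat \<lfloor>l e * Suc N\<rfloor>)"
      have "0 \<le> l e * Suc N"
        using le by simp
      then have floor: "real (nat \<lfloor>l e * Suc N\<rfloor>) \<le> l e * Suc N"
        "l e * Suc N \<le> real (Suc (nat \<lfloor>l e * Suc N\<rfloor>))"
        by linarith+
      have "real k \<le> real (nat \<lfloor>l e * Suc N\<rfloor>)"
        unfolding k_def of_nat_le_iff by simp
      with floor(1) have "real k \<le> l e * Suc N"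
        by linarith
      moreover have "l e * Suc N \<le> real (Suc k)"
      proof (cases "N \<le> nat \<lfloor>l e * Suc N\<rfloor>")
        case True
        then show ?thesis
          using le by (simp add: k_def mult_left_le_one_le)
      next
        case False
        then show ?thesis
          using floor(2) by (simp add: k_def)
      qed
      ultimately have "l e \<in> I k"
        by (simp add: I_def field_simps)
      then have "l \<in> B k" "k < Suc N"
        using l by (auto simp: B_def k_def)
      then show "l \<in> (\<Union>k<Suc N. B k)"
        by blast
    qed
    then have "prob ?D \<le> prob (\<Union>k<Suc N. B k)"
      using B by (intro finite_measure_mono) auto
    also have "\<dots> \<le> (\<Sum>k<Suc N. prob (B k))"
      using B by (intro finite_measure_subadditive_finite) auto
    \<comment> \<open>By independence both labels lie in a given piece with probability the square
      of its length; the \<open>N + 1\<close> squares add up to only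
      \<open>1 / Suc N\<close>.\<close>
    also have "\<dots> = (\<Sum>k<Suc N. (1 / Suc N)\<^sup>2)"
    proof (intro sum.cong refl)
      fix k assume "k \<in> {..<Suc N}"
      then have "prob (B k) = (real (Suc k) / Suc N - real k / Suc N) ^ card {e, f}"
        unfolding B_def I_def using e
        by (intro measure_label_box) (auto simp: field_simps)
      also have "\<dots> = (1 / Suc N)\<^sup>2"
        using e(3) by (simp add: diff_divide_distrib[symmetric] power2_eq_square)
      finally show "prob (B k) = (1 / Suc N)\<^sup>2" .
    qed
    also have "\<dots> = 1 / Suc N"
      by (simp add: power2_eq_square)
    finally show ?thesis .
  qed
  moreover have "(\<lambda>N. 1 / real (Suc N)) \<longlonglongrightarrow> 0"
    using LIMSEQ_inverse_real_of_nat by (simp add: inverse_eq_divide)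
  ultimately have "prob ?D \<le> 0"
    by (intro LIMSEQ_le_const) auto
  then have "prob ?D = 0"
    using measure_nonneg[of ?M ?D] by linarith
  then show ?thesis
    using D by (subst AE_iff_measurable[OF D]) (auto simp: emeasure_eq_measure)
qed

subsection \<open>Bounds for the expected degree\<close>

text \<open>The event is the preimage under \<open>fmsf_map\<close> of a coordinate event.\<close>

lemma kept_edge_measurable:
  assumes "countable (arcs G)" "e \<in> edges G arev"
  shows "{l \<in> space (label_measure G arev). \<not> removed_edge G arev l e} \<in> sets (label_measure G arev)"
proof -
  have "(\<lambda>s. s e) \<in> subgraph_space G arev \<rightarrow>\<^sub>M count_space UNIV"
    unfolding subgraph_space_def using assms(2) by (rule measurable_component_singleton)
  from measurable_compose[OF fmsf_map_measurable[OF assms(1)] this]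
  have "Measurable.pred (label_measure G arev) (\<lambda>l. \<not> removed_edge G arev l e)"
    using assms(2) by (simp add: fmsf_map_def)
  then show ?thesis
    by (simp add: pred_def)
qed

lemma subgraph_degree_fmsf_map:
  "subgraph_degree G arev (fmsf_map G arev l) x
    = card {a \<in> out_arcs G x. \<not> removed_edge G arev l (unoriented arev a)}"
  unfolding subgraph_degree_def
  by (intro arg_cong[where f = card]) (auto simp: fmsf_map_def edges_def)

text \<open>Change of variables for the push-forward: the expectation moves to the labellings, where
  events can be estimated.\<close>

lemma
  assumes "countable (arcs G)" "finite (out_arcs G x)"
  shows integrable_kept_degree: "integrable (label_measure G arev)
      (\<lambda>l. real (card {a \<in> out_arcs G x. \<not> removed_edge G arev l (unoriented arev a)}))"
    and delta_FMSF_eq: "delta_FMSF G arev x = (\<integral>l. real (card {a \<in> out_arcs G x.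
      \<not> removed_edge G arev l (unoriented arev a)}) \<partial>label_measure G arev)"
proof -
  have m: "fmsf_map G arev \<in> label_measure G arev \<rightarrow>\<^sub>M subgraph_space G arev"
    by (rule fmsf_map_measurable[OF assms(1)])
  have i: "integrable (FMSF G arev) (\<lambda>s. real (subgraph_degree G arev s x))"
    by (rule integrable_subgraph_degree[OF assms])
  then have b: "(\<lambda>s. real (subgraph_degree G arev s x)) \<in> borel_measurable (subgraph_space G arev)"
    by (auto simp: FMSF_def dest: borel_measurable_integrable)
  show "integrable (label_measure G arev)
      (\<lambda>l. real (card {a \<in> out_arcs G x. \<not> removed_edge G arev l (unoriented arev a)}))"
    using i unfolding FMSF_def integrable_distr_eq[OF m b] subgraph_degree_fmsf_map .
  show "delta_FMSF G arev x = (\<integral>l. real (card {a \<in> out_arcs G x.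
      \<not> removed_edge G arev l (unoriented arev a)}) \<partial>label_measure G arev)"
    unfolding delta_FMSF_def FMSF_def integral_distr[OF m b] subgraph_degree_fmsf_map ..
qed

text \<open>Linearity of expectation over the arcs at \<open>x\<close>.\<close>

lemma delta_FMSF_eq_sum:
  assumes "countable (arcs G)" "finite (out_arcs G x)"
  shows "delta_FMSF G arev x = (\<Sum>a\<in>out_arcs G x. measure (label_measure G arev)
    {l \<in> space (label_measure G arev). \<not> removed_edge G arev l (unoriented arev a)})"
proof -
  let ?M = "label_measure G arev"
  let ?K = "\<lambda>a. {l \<in> space ?M. \<not> removed_edge G arev l (unoriented arev a)}"
  interpret prob_space ?M
    by (rule prob_space_label_measure)
  have K: "?K a \<in> events" if "a \<in> out_arcs G x" for a
    using that by (intro kept_edge_measurable assms) (auto simp: edges_def)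
  have "delta_FMSF G arev x = (\<integral>l. (\<Sum>a\<in>out_arcs G x. indicator (?K a) l) \<partial>?M)"
    unfolding delta_FMSF_eq[OF assms]
  proof (rule Bochner_Integration.integral_cong)
    fix l assume "l \<in> space ?M"
    then have "(\<Sum>a\<in>out_arcs G x. indicator (?K a) l)
        = (\<Sum>a\<in>out_arcs G x. if \<not> removed_edge G arev l (unoriented arev a) then 1 else 0 :: real)"
      by (intro sum.cong) (auto simp: indicator_def)
    also have "\<dots> = real (card {a \<in> out_arcs G x. \<not> removed_edge G arev l (unoriented arev a)})"
      using assms(2) by (simp add: sum.If_cases Int_def)
    finally show "real (card {a \<in> out_arcs G x. \<not> removed_edge G arev l (unoriented arev a)})
        = (\<Sum>a\<in>out_arcs G x. indicator (?K a) l)" ..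
  qed simp
  also have "\<dots> = (\<Sum>a\<in>out_arcs G x. prob (?K a))"
    using K by (subst Bochner_Integration.integral_sum)
      (auto simp del: in_out_arcs_conv simp: less_top[symmetric])
  finally show ?thesis .
qed

lemma delta_FMSF_le_out_degree:
  assumes "countable (arcs G)" "finite (out_arcs G x)"
  shows "delta_FMSF G arev x \<le> real (out_degree G x)"
proof -
  interpret prob_space "label_measure G arev"
    by (rule prob_space_label_measure)
  show ?thesis
    unfolding delta_FMSF_eq_sum[OF assms] out_degree_def
    by (rule order_trans[OF sum_mono[where g = "\<lambda>_. 1"]]) auto
qed

text \<open>Only finitely many edges meet \<open>x\<close>, so their labels are almost surely
  distinct, and then \<open>exists_kept_arc\<close> provides a kept arc.\<close>

lemma (in bidirected_digraph) delta_FMSF_ge_1: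
  assumes "countable (arcs G)" "finite (out_arcs G x)" "\<exists>a\<in>out_arcs G x. head G a \<noteq> x"
  shows "delta_FMSF G arev x \<ge> 1"
proof -
  let ?M = "label_measure G arev"
  let ?E = "unoriented arev ` out_arcs G x"
  interpret prob_space ?M
    by (rule prob_space_label_measure)
  have E: "?E \<subseteq> edges G arev" "finite ?E"
    using assms(2) by (auto simp: edges_def)
  have "AE l in ?M. \<forall>e\<in>?E. \<forall>f\<in>?E. e \<noteq> f \<longrightarrow> l e \<noteq> l f"
  proof (intro AE_finite_allI E(2))
    fix e f assume "e \<in> ?E" "f \<in> ?E"
    then show "AE l in ?M. e \<noteq> f \<longrightarrow> l e \<noteq> l f"
      using E(1) AE_labels_distinct[of e G arev f] by (cases "e = f") auto
  qed
  then have "AE l in ?M. 1 \<le> real (card {a \<in> out_arcs G x. \<not> removed_edge G arev l (unoriented arev a)})"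
  proof (rule AE_mp, intro AE_I2 impI)
    fix l :: "'b set \<Rightarrow> real"
    assume "\<forall>e\<in>?E. \<forall>f\<in>?E. e \<noteq> f \<longrightarrow> l e \<noteq> l f"
    then have "inj_on l ?E"
      by (meson inj_onI)
    then have "{a \<in> out_arcs G x. \<not> removed_edge G arev l (unoriented arev a)} \<noteq> {}"
      using exists_kept_arc[OF _ assms(2,3)] by blast
    moreover have "finite {a \<in> out_arcs G x. \<not> removed_edge G arev l (unoriented arev a)}"
      using assms(2) by (rule rev_finite_subset) auto
    ultimately show "1 \<le> real (card {a \<in> out_arcs G x. \<not> removed_edge G arev l (unoriented arev a)})"
      by (simp add: Suc_le_eq card_gt_0_iff)
  qed
  then show ?thesis
    unfolding delta_FMSF_eq[OF assms(1,2)]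
    by (intro integral_ge_const integrable_kept_degree assms)
qed

section \<open>Union bound over closed walks\<close>

context locally_finite_regular
begin

text \<open>Closed walks with different first arcs are different; \<open>n\<close> counts the arcs
  after the first, hence \<open>Suc n\<close>.\<close>

lemma sum_card_cycles_by_first_arc:
  assumes "x \<in> verts G"
  shows "(\<Sum>a\<in>out_arcs G x. card {q. awalk x (a # q) x \<and> length q = n})
    \<le> num_rooted_cycles G x (Suc n)"
proof -
  let ?C = "\<lambda>a. {q. awalk x (a # q) x \<and> length q = n}"
  have fin: "finite (Cons a ` ?C a)" for a
    by (rule finite_subset[OF _ finite_closed_walks[of x "Suc n"]]) auto
  have "(\<Sum>a\<in>out_arcs G x. card (?C a)) = (\<Sum>a\<in>out_arcs G x. card (Cons a ` ?C a))"
    by (simp add: card_image)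
  also have "\<dots> = card (\<Union>a\<in>out_arcs G x. Cons a ` ?C a)"
    using fin finite_out_arcs[OF assms] by (intro card_UN_disjoint[symmetric]) auto
  also have "\<dots> \<le> num_rooted_cycles G x (Suc n)"
    unfolding num_rooted_cycles_def by (intro card_mono finite_closed_walks) auto
  finally show ?thesis .
qed

text \<open>The label of \<open>a\<close> is at most \<open>p\<close> with probability
  \<open>p\<close>. The subtracted series bounds the probability that, in addition, \<open>a\<close>
  is removed: it is a union bound over the closed walks starting with \<open>a\<close> whose labels
  are all at most \<open>p\<close>.\<close>

lemma prob_kept_ge:
  fixes p :: real
  assumes "countable (arcs G)" "a \<in> out_arcs G x" "0 \<le> p" "p \<le> 1"
    and sums: "summable (\<lambda>n. real (card {q. awalk x (a # q) x \<and> length q = n}) * p ^ Suc n)"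
  shows "p - (\<Sum>n. real (card {q. awalk x (a # q) x \<and> length q = n}) * p ^ Suc n)
    \<le> measure (label_measure G arev)
        {l \<in> space (label_measure G arev). \<not> removed_edge G arev l (unoriented arev a)}"
proof -
  let ?M = "label_measure G arev"
  let ?K = "{l \<in> space ?M. \<not> removed_edge G arev l (unoriented arev a)}"
  let ?W = "\<lambda>n. {q. awalk x (a # q) x \<and> length q = n}"
  \<comment> \<open>Distinctness makes the box of a walk impose exactly \<open>Suc n\<close>
    independent constraints; it is dropped again when the walks are counted.\<close>
  define W where "W n = {q \<in> ?W n. distinct (map (unoriented arev) (a # q))}" for n
  define B where "B J = {l \<in> space ?M. \<forall>e\<in>J. l e \<in> {0..p}}" for J
  define T where "T n = (\<Union>q\<in>W n. B (unoriented arev ` set (a # q)))" for n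
  interpret prob_space ?M
    by (rule prob_space_label_measure)
  have a: "unoriented arev a \<in> edges G arev"
    using assms(2) by (auto simp: edges_def)
  have K: "?K \<in> events"
    by (rule kept_edge_measurable[OF assms(1) a])
  have finW': "finite (?W n)" for n
  proof -
    have "finite (Cons a ` ?W n)"
      by (rule finite_subset[OF _ finite_closed_walks[of x "Suc n"]]) auto
    then show ?thesis
      by (rule finite_imageD) simp
  qed
  have finW: "finite (W n)" for n
    using finW'[of n] by (rule rev_finite_subset) (auto simp: W_def)
  have edges: "unoriented arev ` set (a # q) \<subseteq> edges G arev" if "q \<in> W n" for q n
  proof -
    have "awalk x (a # q) x"
      using that by (auto simp: W_def)
    then have "set (a # q) \<subseteq> arcs G"
      by blast
    then show ?thesis
      by (auto simp: edges_def)
  qed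
  have B: "B J \<in> events" if "finite J" "J \<subseteq> edges G arev" for J
  proof -
    have "Measurable.pred ?M (\<lambda>l. l e \<in> {0..p})" if "e \<in> J" for e
    proof -
      have "e \<in> edges G arev"
        using that \<open>J \<subseteq> _\<close> by blast
      then show ?thesis
        by measurable
    qed
    then show ?thesis
      unfolding B_def using \<open>finite J\<close> by measurable
  qed
  have T: "T n \<in> events" for n
    unfolding T_def by (intro sets.finite_UN B finW edges finite_imageI finite_set)
  have T_le: "prob (T n) \<le> real (card (?W n)) * p ^ Suc n" for n
  proof -
    have "(\<lambda>q. B (unoriented arev ` set (a # q))) ` W n \<subseteq> events"
      by (intro image_subsetI B edges finite_imageI finite_set)
    then have "prob (T n) \<le> (\<Sum>q\<in>W n. prob (B (unoriented arev ` set (a # q))))"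
      unfolding T_def by (intro finite_measure_subadditive_finite finW)
    also have "\<dots> = (\<Sum>q\<in>W n. p ^ Suc n)"
    proof (intro sum.cong refl)
      fix q assume q: "q \<in> W n"
      then have "card (unoriented arev ` set (a # q)) = Suc n"
        using distinct_card[of "map (unoriented arev) (a # q)"] by (simp add: W_def)
      then show "prob (B (unoriented arev ` set (a # q))) = p ^ Suc n"
        unfolding B_def using measure_label_box[OF _ edges[OF q], of 0 p] assms by simp
    qed
    also have "\<dots> \<le> real (card (?W n)) * p ^ Suc n"
    proof -
      have "card (W n) \<le> card (?W n)"
        by (intro card_mono finW') (auto simp: W_def)
      then show ?thesis
        using assms(3) by (simp add: mult_right_mono)
    qed
    finally show ?thesis .
  qed
  have sumT: "summable (\<lambda>n. prob (T n))"
    by (rule summable_comparison_test'[OF sums, of 0]) (use T_le in auto)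
  \<comment> \<open>If \<open>a\<close> is removed, its label is maximal on the cycle found, so its
    bound \<open>p\<close> passes to all labels there.\<close>
  have "B {unoriented arev a} \<subseteq> ?K \<union> (\<Union>n. T n)"
  proof
    fix l assume l: "l \<in> B {unoriented arev a}"
    show "l \<in> ?K \<union> (\<Union>n. T n)"
    proof (cases "removed_edge G arev l (unoriented arev a)")
      case True
      then obtain q where q: "awalk x (a # q) x" "distinct (map (unoriented arev) (a # q))"
        "\<And>e. e \<in> unoriented arev ` set (a # q) \<Longrightarrow> l e \<le> l (unoriented arev a)"
        using assms(2) by (rule removed_edgeE) blast
      have "q \<in> W (length q)"
        using q by (simp add: W_def)
      moreover have "l e \<in> {0..p}" if "e \<in> unoriented arev ` set (a # q)" for e
      proof -
        have "e \<in> edges G arev"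
          using edges[OF \<open>q \<in> W (length q)\<close>] that by blast
        then have "l e \<in> {0..1}"
          using l unfolding B_def by (intro label_in_unit_interval) auto
        then show ?thesis
          using q(3)[OF that] l by (simp add: B_def)
      qed
      ultimately have "l \<in> T (length q)"
        using l unfolding T_def B_def by blast
      then show ?thesis by blast
    qed (use l in \<open>auto simp: B_def\<close>)
  qed
  then have "prob (B {unoriented arev a}) \<le> prob (?K \<union> (\<Union>n. T n))"
    using K T by (intro finite_measure_mono) auto
  also have "\<dots> \<le> prob ?K + prob (\<Union>n. T n)"
    using K T by (intro measure_Un_le) auto
  also have "prob (\<Union>n. T n) \<le> (\<Sum>n. prob (T n))"
    using T sumT by (intro finite_measure_subadditive_countably) auto
  also have "\<dots> \<le> (\<Sum>n. real (card (?W n)) * p ^ Suc n)"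
    using T_le sumT sums by (rule suminf_le)
  also have "prob (B {unoriented arev a}) = p"
    unfolding B_def using measure_label_box[of "{unoriented arev a}" G arev 0 p] a assms by simp
  finally show ?thesis
    by simp
qed

lemma delta_FMSF_ge_growth_rate:
  assumes "countable (arcs G)" "x \<in> verts G" "1 \<le> L"
    and growth: "\<And>n. real (num_rooted_cycles G x n) \<le> L ^ n"
  shows "delta_FMSF G arev x \<ge> real d / (2 * L) - 1"
proof -
  define p where "p = 1 / (2 * L)"
  \<comment> \<open>\<open>1 \<le> L\<close> keeps the threshold inside the unit interval.\<close>
  have p: "0 \<le> p" "p \<le> 1" "L * p = 1 / 2"
    using assms(3) by (auto simp: p_def)
  let ?t = "\<lambda>a n. real (card {q. awalk x (a # q) x \<and> length q = n}) * p ^ Suc n"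
  have sum_le: "(\<Sum>a\<in>out_arcs G x. ?t a n) \<le> (1 / 2) ^ Suc n" for n
  proof -
    have "(\<Sum>a\<in>out_arcs G x. ?t a n)
        = real (\<Sum>a\<in>out_arcs G x. card {q. awalk x (a # q) x \<and> length q = n}) * p ^ Suc n"
      by (simp add: sum_distrib_right)
    also have "\<dots> \<le> real (num_rooted_cycles G x (Suc n)) * p ^ Suc n"
      using sum_card_cycles_by_first_arc[OF assms(2)] p
      by (intro mult_right_mono) (auto simp del: of_nat_sum)
    also have "\<dots> \<le> L ^ Suc n * p ^ Suc n"
      using growth[of "Suc n"] p(1) by (intro mult_right_mono) simp_all
    also have "\<dots> = (1 / 2) ^ Suc n"
      by (metis p(3) power_mult_distrib)
    finally show ?thesis .
  qed
  have half: "(\<lambda>n. (1 / 2 :: real) ^ Suc n) sums 1"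
    by (rule power_half_series)
  have nonneg: "0 \<le> ?t a n" for a n
    using p by simp
  have sums: "summable (?t a)" if "a \<in> out_arcs G x" for a
  \<comment> \<open>The series of a single arc is dominated by the sum over all arcs at
    \<open>x\<close>, hence by the geometric series.\<close>
  proof (rule summable_comparison_test'[OF sums_summable[OF half], of 0])
    fix n :: nat
    have "?t a n \<le> (\<Sum>a\<in>out_arcs G x. ?t a n)"
      using that nonneg finite_out_arcs[OF assms(2)] by (intro member_le_sum) auto
    with sum_le[of n] nonneg[of a n] show "norm (?t a n) \<le> (1 / 2) ^ Suc n"
      by simp
  qed
  have "(\<Sum>a\<in>out_arcs G x. \<Sum>n. ?t a n) = (\<Sum>n. \<Sum>a\<in>out_arcs G x. ?t a n)"
    using sums by (rule suminf_sum[symmetric])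
  also have "\<dots> \<le> (\<Sum>n. (1 / 2) ^ Suc n)"
    using sum_le summable_sum[OF sums] sums_summable[OF half] by (rule suminf_le)
  also have "\<dots> = 1"
    by (rule sums_unique[OF half, symmetric])
  finally have "(\<Sum>a\<in>out_arcs G x. \<Sum>n. ?t a n) \<le> 1" .
  then have "real d / (2 * L) - 1 \<le> (\<Sum>a\<in>out_arcs G x. p - (\<Sum>n. ?t a n))"
    using out_degree_eq[OF assms(2)] by (simp add: sum_subtractf out_degree_def p_def)
  also have "\<dots> \<le> delta_FMSF G arev x"
    unfolding delta_FMSF_eq_sum[OF assms(1) finite_out_arcs[OF assms(2)]]
    using p sums by (intro sum_mono prob_kept_ge assms(1)) auto
  finally show ?thesis .
qed

end

section \<open>Combination of the two lower bounds\<close>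

theorem theorem1:
  fixes G :: "('a,'b) pre_digraph" and arev :: "'b \<Rightarrow> 'b" and x :: 'a and d :: nat
  assumes "bidirected_digraph G arev"
    and "strongly_connected G"
    and "vertex_transitive G arev"
    and "x \<in> verts G"
    and "finite (out_arcs G x)"
    and "out_degree G x = d"
    and "d \<ge> 1"
  shows "1 / (4 * spectral_radius G x) - 1 / 4 \<le> delta_FMSF G arev x
    \<and> delta_FMSF G arev x \<le> real d"
proof -
  interpret bidirected_digraph G arev by fact
  interpret locally_finite_regular G arev d
    using vertex_transitive_out_arcs[OF assms(3) wf_digraph_axioms assms(4) _ assms(5)] assms(6)
    by unfold_locales auto
  have countable: "countable (arcs G)"
    using assms(2) finite_out_arcs by (rule countable_arcs_if_locally_finite)
  define L where "L = real d * spectral_radius G x"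
  note L = growth_rate[OF assms(4,7) L_def]
  define u where "u = real d / L"
  have u: "1 / (4 * spectral_radius G x) = u / 4"
    using assms(7) by (simp add: u_def L_def)
  have "u / 2 - 1 \<le> delta_FMSF G arev x"
    using delta_FMSF_ge_growth_rate[OF countable assms(4) L(2,1)] by (simp add: u_def)
  moreover have "u / 4 - 1 / 4 \<le> delta_FMSF G arev x" if "u \<le> 5"
  proof (cases "\<exists>a\<in>out_arcs G x. head G a \<noteq> x")
    case True
    then show ?thesis
      using delta_FMSF_ge_1[OF countable assms(5)] that by simp
  next
    case False
    \<comment> \<open>With only loops \<open>L \<ge> d\<close>, so the claimed lower bound is at
      most 0, and a sum of probabilities suffices.\<close>
    then have "u \<le> 1"
      using L(2,3) by (simp add: u_def)
    then show ?thesis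
      unfolding delta_FMSF_eq_sum[OF countable assms(5)]
      by (intro order_trans[OF _ sum_nonneg]) auto
  qed
  \<comment> \<open>The two bounds overlap for \<open>u\<close> between 3 and 5, so any split point
    there would do.\<close>
  ultimately have "1 / (4 * spectral_radius G x) - 1 / 4 \<le> delta_FMSF G arev x"
    unfolding u by (cases "u \<le> 5") auto
  then show ?thesis
    using delta_FMSF_le_out_degree[OF countable assms(5)] assms(6) by simp
qed

end
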